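(* Suppose $n\ge3$ and $0\le l<k\le n$ are integers. Then: (1) If $k-l\ge2$, then $\widetilde{\mathscr{A}}_{k,l}=\mathscr{A}_{k,l}$. (2) $\widetilde{\mathscr{A}}_{n,0}=\mathscr{A}_{n,0}$ and $m_{n,0}\equiv n$ (on $\Gamma^+$). (3) $c_*I\in\widetilde{\mathscr{A}}_{k,l}$ and $m_{k,l}(c_*(1,1,\dots,1))=n$, where $I$ is the $n\times n$ identity matrix and \[c_*=\left(\frac{C_n^l}{C_n^k}\right)^{\frac1{k-l}},\qquad C_n^i=\frac{n!}{i!(n-i)!}.\]
   Context: Elementary symmetric functions: for $p\in\mathbb{R}^n$, $\sigma_k(p)=\sum_{1\le s_1<\dots<s_k\le n}p_{s_1}\cdots p_{s_k}$ for $1\le k\le n$, $\sigma_0\equiv1$, $\sigma_{-1}\equiv0$; and $\sigma_{k;i}(p)$ denotes $\sigma_k$ evaluated at $p$ with $p_i$ replaced by $0$ (so $\sigma_{-1;i}\equiv0$). $S(n)$ is the space of real symmetric $n\times n$ matrices, $\lambda(M)$ is the vector of eigenvalues of $M\in S(n)$, and $\Gamma^+=\{\lambda\in\mathbb{R}^n:\lambda_i>0\ \forall i\}$. For $a\in\Gamma^+$, $0\le k\le n$ and $x\in\mathbb{R}^n\setminus\{0\}$ let \[\Xi_k(a,x)=\frac{\sum_{i=1}^n\sigma_{k-1;i}(a)a_i^2x_i^2}{\sigma_k(a)\sum_{i=1}^na_ix_i^2},\qquad \overline\xi_k(a)=\sup_{x\ne0}\Xi_k(a,x),\qquad \underline\xi_k(a)=\inf_{x\neq0}\Xi_k(a,x),\]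 and for $0\le l<k\le n$ let $m_{k,l}(a)=\dfrac{k-l}{\overline\xi_k(a)-\underline\xi_l(a)}$. Define $\mathscr{A}_{k,l}=\{A\in S(n):\lambda(A)\in\Gamma^+,\ \sigma_k(\lambda(A))=\sigma_l(\lambda(A))\}$ and $\widetilde{\mathscr{A}}_{k,l}=\{A\in\mathscr{A}_{k,l}: m_{k,l}(\lambda(A))>2\}$. *)

theory Defs
  imports "HOL-Analysis.Analysis"
begin

text \<open>The dimension \<open>n\<close> is \<open>CARD('n)\<close>. The increasing tuples
  \<open>s\<^sub>1 < \<dots> < s\<^sub>k\<close> are the \<open>k\<close>-element subsets of the index type. The order is an
  integer, so that the conventions \<open>\<sigma>\<^sub>0 = 1\<close> and \<open>\<sigma>\<^bsub>-1\<^esub> = 0\<close> are instances of the formula.\<close>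

definition esym :: "int \<Rightarrow> real ^ 'n \<Rightarrow> real" where
  "esym k p = (\<Sum>S | S \<subseteq> (UNIV :: 'n set) \<and> int (card S) = k. \<Prod>i\<in>S. p $ i)"

definition esym_omit :: "int \<Rightarrow> 'n \<Rightarrow> real ^ 'n \<Rightarrow> real" where
  "esym_omit k i p = esym k (\<chi> j. if j = i then 0 else p $ j)"

definition pos_cone :: "(real ^ 'n) set" where
  "pos_cone = {a. \<forall>i. 0 < a $ i}"

definition sym_matrices :: "(real ^ 'n ^ 'n) set" where
  "sym_matrices = {M. transpose M = M}"

text \<open>The vector of eigenvalues, listed with algebraic multiplicity: the roots of the
  characteristic polynomial. For symmetric \<open>M\<close> such a vector exists and is unique up to
  the order of its entries. The order is chosen arbitrarily; everything below is invariant
  under permuting the entries of \<open>eigenvalues M\<close>.\<close>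

definition eigenvalues :: "real ^ 'n ^ 'n \<Rightarrow> real ^ 'n" where
  "eigenvalues M = (SOME v. \<forall>t. det (t *\<^sub>R mat 1 - M) = (\<Prod>i\<in>UNIV. t - v $ i))"

definition Xi :: "nat \<Rightarrow> real ^ 'n \<Rightarrow> real ^ 'n \<Rightarrow> real" where
  "Xi k a x = (\<Sum>i\<in>UNIV. esym_omit (int k - 1) i a * (a $ i)\<^sup>2 * (x $ i)\<^sup>2)
                / (esym (int k) a * (\<Sum>i\<in>UNIV. a $ i * (x $ i)\<^sup>2))"

definition xi_upper :: "nat \<Rightarrow> real ^ 'n \<Rightarrow> real" where
  "xi_upper k a = (SUP x \<in> {x. x \<noteq> 0}. Xi k a x)"

definition xi_lower :: "nat \<Rightarrow> real ^ 'n \<Rightarrow> real" where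
  "xi_lower k a = (INF x \<in> {x. x \<noteq> 0}. Xi k a x)"

definition m_quot :: "nat \<Rightarrow> nat \<Rightarrow> real ^ 'n \<Rightarrow> real" where
  "m_quot k l a = (real k - real l) / (xi_upper k a - xi_lower l a)"

definition A_set :: "nat \<Rightarrow> nat \<Rightarrow> (real ^ 'n ^ 'n) set" where
  "A_set k l = {A \<in> sym_matrices. eigenvalues A \<in> pos_cone \<and>
                  esym (int k) (eigenvalues A) = esym (int l) (eigenvalues A)}"

definition A_tilde :: "nat \<Rightarrow> nat \<Rightarrow> (real ^ 'n ^ 'n) set" where
  "A_tilde k l = {A \<in> A_set k l. m_quot k l (eigenvalues A) > 2}"

definition c_star :: "nat \<Rightarrow> nat \<Rightarrow> nat \<Rightarrow> real" where
  "c_star n k l = (real (n choose l) / real (n choose k)) powr (1 / (real k - real l))"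

end

(* Xi_k(a,x) is a weighted mean, with weights a_i x_i^2, of the ratios
     r_i = a_i sigma_{k-1;i}(a) / sigma_k(a),
   so its supremum and infimum over x are the largest and the smallest ratio. Since
   a_i sigma_{k-1;i} is the part of sigma_k coming from the index sets that contain i, the
   ratios lie in [0,1], are < 1 for k < n and > 0 for k > 0, and add up to k. Hence
     0 < (k-l)/n <= max r^(k) - min r^(l) <= 1,
   where the last inequality is strict unless (k,l) = (n,0). *)
theory Submission
  imports Defs
begin

section \<open>Splitting sigma_k by membership of an index\<close>

lemma mult_esym_omit:
  fixes a :: "real ^ 'n"
  shows "a $ i * esym_omit (k - 1) i a = (\<Sum>S | i \<in> S \<and> int (card S) = k. \<Prod>j\<in>S. a $ j)"
proof -
  let ?b = "\<chi> j. if j = i then 0 else a $ j"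
  \<comment> \<open>A subset containing \<open>i\<close> has a zero factor, and on the others
    zeroing the entry \<open>i\<close> changes nothing. For k \<le> 0 both sides of the lemma are
    empty sums, so the integer order needs no case split.\<close>
  have "esym_omit (k - 1) i a
      = (\<Sum>S | i \<notin> S \<and> int (card S) = k - 1. \<Prod>j\<in>S. ?b $ j)"
    unfolding esym_omit_def esym_def by (rule sum.mono_neutral_right) auto
  also have "\<dots> = (\<Sum>S | i \<notin> S \<and> int (card S) = k - 1. \<Prod>j\<in>S. a $ j)"
    by (intro sum.cong prod.cong) auto
  finally have "a $ i * esym_omit (k - 1) i a
      = (\<Sum>S | i \<notin> S \<and> int (card S) = k - 1. a $ i * (\<Prod>j\<in>S. a $ j))"
    by (simp add: sum_distrib_left)
  also have "\<dots> = (\<Sum>S | i \<in> S \<and> int (card S) = k. \<Prod>j\<in>S. a $ j)"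
  proof (rule sum.reindex_bij_witness[where i = "\<lambda>S. S - {i}" and j = "insert i"])
    fix S :: "'n set" assume S: "S \<in> {S. i \<in> S \<and> int (card S) = k}"
    then have "card S = Suc (card (S - {i}))"
      by (metis (mono_tags, lifting) card_Suc_Diff1 finite mem_Collect_eq)
    with S show "S - {i} \<in> {S. i \<notin> S \<and> int (card S) = k - 1}" by auto
  qed (auto simp: insert_absorb)
  finally show ?thesis .
qed

text \<open>Double counting: the term of a k-set S appears once for each of its k elements. This is
  Euler's identity for the homogeneous polynomial sigma_k.\<close>

lemma sum_mult_esym_omit:
  fixes a :: "real ^ 'n"
  shows "(\<Sum>i\<in>UNIV. a $ i * esym_omit (int k - 1) i a) = real k * esym (int k) a"
proof -
  let ?P = "\<lambda>S. \<Prod>j\<in>S. a $ j"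
  have "(\<Sum>i\<in>UNIV. a $ i * esym_omit (int k - 1) i a)
      = (\<Sum>i\<in>UNIV. \<Sum>S | S \<in> {S. int (card S) = int k} \<and> i \<in> S. ?P S)"
    unfolding mult_esym_omit by (intro sum.cong) auto
  also have "\<dots> = (\<Sum>S | int (card S) = int k. \<Sum>i | i \<in> UNIV \<and> i \<in> S. ?P S)"
    by (rule sum.swap_restrict) auto
  also have "\<dots> = (\<Sum>S | int (card S) = int k. real k * ?P S)"
    by (intro sum.cong) auto
  finally show ?thesis by (simp add: esym_def sum_distrib_left)
qed

lemma prod_pos_cone:
  fixes a :: "real ^ 'n"
  assumes "a \<in> pos_cone"
  shows "0 < (\<Prod>i\<in>S. a $ i)"
  using assms by (intro prod_pos) (simp add: pos_cone_def)

lemma esym_pos: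
  fixes a :: "real ^ 'n"
  assumes "a \<in> pos_cone" "k \<le> CARD('n)"
  shows "0 < esym (int k) a"
proof -
  obtain S :: "'n set" where "card S = k"
    using assms(2) by (rule obtain_subset_with_card_n)
  then show ?thesis
    unfolding esym_def using assms(1)
    by (intro sum_pos2[where i = S]) (auto simp: prod_pos_cone less_imp_le)
qed

text \<open>The logarithmic derivative of sigma_k with respect to log a_i. For positive
  \<open>a\<close> and k \<le> n it is also the probability that \<open>i\<close> lies in a random
  k-set drawn with weight proportional to the product of its entries, which makes the bounds below
  natural.\<close>

definition esym_ratio :: "nat \<Rightarrow> real ^ 'n \<Rightarrow> 'n \<Rightarrow> real" where
  "esym_ratio k a i = a $ i * esym_omit (int k - 1) i a / esym (int k) a"

lemma esym_ratio_nonneg: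
  fixes a :: "real ^ 'n"
  assumes "a \<in> pos_cone" "k \<le> CARD('n)"
  shows "0 \<le> esym_ratio k a i"
  unfolding esym_ratio_def mult_esym_omit
  using assms(1) esym_pos[OF assms]
  by (intro divide_nonneg_pos sum_nonneg) (auto simp: prod_pos_cone less_imp_le)

lemma esym_ratio_pos:
  fixes a :: "real ^ 'n"
  assumes "a \<in> pos_cone" "k \<le> CARD('n)" "0 < k"
  shows "0 < esym_ratio k a i"
proof -
  obtain S where S: "i \<in> S" "card S = k"
    using assms exists_subset_between[of "{i}" k UNIV] by auto
  have "0 < (\<Sum>S | i \<in> S \<and> int (card S) = int k. \<Prod>j\<in>S. a $ j)"
    using S assms(1)
    by (intro sum_pos2[where i = S]) (auto simp: prod_pos_cone less_imp_le)
  then show ?thesis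
    using esym_pos[OF assms(1,2)] by (simp add: esym_ratio_def mult_esym_omit)
qed

lemma esym_ratio_le_1:
  fixes a :: "real ^ 'n"
  assumes "a \<in> pos_cone" "k \<le> CARD('n)"
  shows "esym_ratio k a i \<le> 1"
proof -
  have "a $ i * esym_omit (int k - 1) i a \<le> esym (int k) a"
    unfolding mult_esym_omit esym_def using assms(1)
    by (intro sum_mono2) (auto simp: prod_pos_cone less_imp_le)
  then show ?thesis
    using esym_pos[OF assms] by (simp add: esym_ratio_def)
qed

text \<open>For k < n some k-set avoids \<open>i\<close>, and its positive term is missing from the
  numerator.\<close>

lemma esym_ratio_less_1:
  fixes a :: "real ^ 'n"
  assumes "a \<in> pos_cone" "k < CARD('n)"
  shows "esym_ratio k a i < 1"
proof -
  have "k \<le> card (UNIV - {i})"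
    using assms(2) by simp
  then obtain S where S: "i \<notin> S" "card S = k"
    using exists_subset_between[of "{}" k "UNIV - {i}"] by auto
  have "a $ i * esym_omit (int k - 1) i a < esym (int k) a"
    unfolding mult_esym_omit esym_def using assms(1) S
    by (intro sum_strict_mono2[where b = S])
       (auto simp: prod_pos_cone less_imp_le)
  then show ?thesis
    using esym_pos[of a k] assms by (simp add: esym_ratio_def)
qed

lemma sum_esym_ratio:
  fixes a :: "real ^ 'n"
  assumes "a \<in> pos_cone" "k \<le> CARD('n)"
  shows "(\<Sum>i\<in>UNIV. esym_ratio k a i) = real k"
  using esym_pos[OF assms]
  by (simp add: esym_ratio_def sum_mult_esym_omit flip: sum_divide_distrib)

lemma esym_ratio_card:
  fixes a :: "real ^ 'n"
  assumes "a \<in> pos_cone"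
  shows "esym_ratio CARD('n) a i = 1"
proof -
  have "i \<in> S" if "card S = CARD('n)" for S :: "'n set"
    using that by (metis UNIV_I card_subset_eq finite subset_UNIV)
  then have "a $ i * esym_omit (int CARD('n) - 1) i a = esym (int CARD('n)) a"
    unfolding mult_esym_omit esym_def by (intro sum.cong) auto
  then show ?thesis
    using esym_pos[OF assms order.refl] by (simp add: esym_ratio_def)
qed

lemma esym_ratio_0:
  fixes a :: "real ^ 'n"
  shows "esym_ratio 0 a i = 0"
  unfolding esym_ratio_def mult_esym_omit by auto

section \<open>Extremal values of the weighted mean\<close>

lemma Xi_weighted_mean:
  fixes a x :: "real ^ 'n"
  assumes "a \<in> pos_cone" "k \<le> CARD('n)"
  shows "Xi k a x = (\<Sum>i\<in>UNIV. esym_ratio k a i * (a $ i * (x $ i)\<^sup>2)) / (\<Sum>i\<in>UNIV. a $ i * (x $ i)\<^sup>2)"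
proof -
  have "(\<Sum>i\<in>UNIV. esym_ratio k a i * (a $ i * (x $ i)\<^sup>2))
      = (\<Sum>i\<in>UNIV. esym_omit (int k - 1) i a * (a $ i)\<^sup>2 * (x $ i)\<^sup>2) / esym (int k) a"
    unfolding esym_ratio_def sum_divide_distrib
    by (intro sum.cong) (auto simp: power2_eq_square)
  then show ?thesis by (simp add: Xi_def)
qed

lemma sum_weights_pos:
  fixes a x :: "real ^ 'n"
  assumes "a \<in> pos_cone" "x \<noteq> 0"
  shows "0 < (\<Sum>i\<in>UNIV. a $ i * (x $ i)\<^sup>2)"
proof -
  obtain i where "x $ i \<noteq> 0"
    using assms(2) by (auto simp: vec_eq_iff)
  then show ?thesis
    using assms(1) by (intro sum_pos2[where i = i]) (auto simp: pos_cone_def less_imp_le)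
qed

text \<open>On a coordinate axis all the weight sits on one index. Hence every ratio is a value of
  \<open>Xi\<close>, and the supremum and infimum are attained.\<close>

lemma Xi_axis:
  fixes a :: "real ^ 'n"
  assumes "a \<in> pos_cone" "k \<le> CARD('n)"
  shows "Xi k a (axis i 1) = esym_ratio k a i"
proof -
  have "a $ i \<noteq> 0" using assms(1) by (auto simp: pos_cone_def less_le)
  have sum_axis: "(\<Sum>j\<in>UNIV. f j * (axis i 1 $ j)\<^sup>2) = f i" for f :: "'n \<Rightarrow> real"
    by (subst sum.remove[of _ i]) (auto simp: axis_def)
  show ?thesis
    using \<open>a $ i \<noteq> 0\<close> sum_axis[of "\<lambda>j. esym_ratio k a j * a $ j"] sum_axis[of "($) a"]
    by (simp add: Xi_weighted_mean[OF assms] mult.assoc)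
qed

lemma xi_upper_eq_Max:
  fixes a :: "real ^ 'n"
  assumes "a \<in> pos_cone" "k \<le> CARD('n)"
  shows "xi_upper k a = Max (range (esym_ratio k a))"
  unfolding xi_upper_def
proof (rule cSup_eq_maximum)
  have "Max (range (esym_ratio k a)) \<in> range (esym_ratio k a)"
    by (intro Max_in) auto
  then obtain i where "Max (range (esym_ratio k a)) = esym_ratio k a i"
    by (rule rangeE)
  then have "Max (range (esym_ratio k a)) = Xi k a (axis i 1)"
    by (simp add: Xi_axis[OF assms])
  then show "Max (range (esym_ratio k a)) \<in> Xi k a ` {x. x \<noteq> 0}"
    by (rule image_eqI) simp
next
  fix y assume "y \<in> Xi k a ` {x. x \<noteq> 0}"
  then obtain x where x: "x \<noteq> 0" "y = Xi k a x" by auto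
  have "(\<Sum>i\<in>UNIV. esym_ratio k a i * (a $ i * (x $ i)\<^sup>2))
      \<le> (\<Sum>i\<in>UNIV. Max (range (esym_ratio k a)) * (a $ i * (x $ i)\<^sup>2))"
    using assms(1) by (intro sum_mono mult_right_mono) (auto simp: pos_cone_def less_imp_le)
  then show "y \<le> Max (range (esym_ratio k a))"
    using sum_weights_pos[OF assms(1) x(1)] x(2)
    by (simp add: Xi_weighted_mean[OF assms] divide_le_eq flip: sum_distrib_left)
qed

lemma xi_lower_eq_Min:
  fixes a :: "real ^ 'n"
  assumes "a \<in> pos_cone" "k \<le> CARD('n)"
  shows "xi_lower k a = Min (range (esym_ratio k a))"
  unfolding xi_lower_def
proof (rule cInf_eq_minimum)
  have "Min (range (esym_ratio k a)) \<in> range (esym_ratio k a)"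
    by (intro Min_in) auto
  then obtain i where "Min (range (esym_ratio k a)) = esym_ratio k a i"
    by (rule rangeE)
  then have "Min (range (esym_ratio k a)) = Xi k a (axis i 1)"
    by (simp add: Xi_axis[OF assms])
  then show "Min (range (esym_ratio k a)) \<in> Xi k a ` {x. x \<noteq> 0}"
    by (rule image_eqI) simp
next
  fix y assume "y \<in> Xi k a ` {x. x \<noteq> 0}"
  then obtain x where x: "x \<noteq> 0" "y = Xi k a x" by auto
  have "(\<Sum>i\<in>UNIV. Min (range (esym_ratio k a)) * (a $ i * (x $ i)\<^sup>2))
      \<le> (\<Sum>i\<in>UNIV. esym_ratio k a i * (a $ i * (x $ i)\<^sup>2))"
    using assms(1) by (intro sum_mono mult_right_mono) (auto simp: pos_cone_def less_imp_le)
  then show "Min (range (esym_ratio k a)) \<le> y"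
    using sum_weights_pos[OF assms(1) x(1)] x(2)
    by (simp add: Xi_weighted_mean[OF assms] le_divide_eq flip: sum_distrib_left)
qed

section \<open>Bounds on the gap and on m\<close>

lemma xi_upper_ge:
  fixes a :: "real ^ 'n"
  assumes "a \<in> pos_cone" "k \<le> CARD('n)"
  shows "real k / real CARD('n) \<le> xi_upper k a"
proof -
  \<comment> \<open>The n ratios add up to k, so the largest is at least their average k/n.\<close>
  have "(\<Sum>i\<in>UNIV. esym_ratio k a i) \<le> real CARD('n) * xi_upper k a"
    by (rule sum_bounded_above) (simp add: xi_upper_eq_Max[OF assms])
  then show ?thesis
    by (simp add: sum_esym_ratio[OF assms] divide_le_eq mult.commute)
qed

lemma xi_lower_le:
  fixes a :: "real ^ 'n"
  assumes "a \<in> pos_cone" "k \<le> CARD('n)"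
  shows "xi_lower k a \<le> real k / real CARD('n)"
proof -
  have "real CARD('n) * xi_lower k a \<le> (\<Sum>i\<in>UNIV. esym_ratio k a i)"
    by (rule sum_bounded_below) (simp add: xi_lower_eq_Min[OF assms])
  then show ?thesis
    by (simp add: sum_esym_ratio[OF assms] le_divide_eq mult.commute)
qed

lemma m_quot_card_0:
  fixes a :: "real ^ 'n"
  assumes "a \<in> pos_cone"
  shows "m_quot CARD('n) 0 a = real CARD('n)"
proof -
  have "esym_ratio CARD('n) a = (\<lambda>_. 1)" "esym_ratio 0 a = (\<lambda>_. 0)"
    using assms by (auto simp: esym_ratio_card esym_ratio_0)
  then show ?thesis
    using assms by (simp add: m_quot_def xi_upper_eq_Max xi_lower_eq_Min)
qed

text \<open>Outside the case (n,0) the gap in the denominator is positive and strictly below 1, so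
  the quotient exceeds k - l. In the case (n,0) the gap is exactly 1 and the quotient is n, which is
  where n \<ge> 3 enters.\<close>

lemma m_quot_gt_2:
  fixes a :: "real ^ 'n"
  assumes a: "a \<in> pos_cone" and n: "CARD('n) \<ge> 3" and kl: "k - l \<ge> 2" "k \<le> CARD('n)"
  shows "m_quot k l a > 2"
proof (cases "k = CARD('n) \<and> l = 0")
  case True
  then show ?thesis using n m_quot_card_0[OF a] by simp
next
  case False
  have l: "l \<le> CARD('n)" using kl by simp
  have "real l / real CARD('n) < real k / real CARD('n)"
    using kl by (intro divide_strict_right_mono) auto
  \<comment> \<open>The sign matters: a zero gap would make the quotient 0 by convention, and a
    negative one would make it negative.\<close>
  then have pos: "xi_upper k a - xi_lower l a > 0"
    using xi_upper_ge[OF a kl(2)] xi_lower_le[OF a l] by linarith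
  have "xi_upper k a \<le> 1" and "xi_lower l a \<ge> 0"
    using esym_ratio_le_1[OF a kl(2)] esym_ratio_nonneg[OF a l]
    by (auto simp: xi_upper_eq_Max[OF a kl(2)] xi_lower_eq_Min[OF a l])
  \<comment> \<open>Either k < n, so that all ratios of order k are below 1, or l > 0, so that all
    ratios of order l are positive.\<close>
  moreover have "xi_upper k a < 1 \<or> xi_lower l a > 0"
    using False esym_ratio_less_1[OF a, of k] esym_ratio_pos[OF a l] kl(2)
    by (auto simp: xi_upper_eq_Max[OF a kl(2)] xi_lower_eq_Min[OF a l])
  moreover have "real k - real l \<ge> 2" using kl by linarith
  ultimately show ?thesis
    using pos by (auto simp: m_quot_def less_divide_eq)
qed

section \<open>Constant vectors and multiples of the identity\<close>

lemma esym_const: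
  "esym (int k) (c *\<^sub>R (\<chi> i. 1) :: real ^ 'n) = real (CARD('n) choose k) * c ^ k"
proof -
  have "card {S. S \<subseteq> (UNIV :: 'n set) \<and> card S = k} = CARD('n) choose k"
    by (rule n_subsets) simp
  then show ?thesis by (simp add: esym_def)
qed

lemma esym_omit_const:
  fixes i j :: "'n::finite"
  shows "esym_omit k i (c *\<^sub>R (\<chi> i. 1) :: real ^ 'n) = esym_omit k j (c *\<^sub>R (\<chi> i. 1))"
proof -
  \<comment> \<open>Swapping \<open>i\<close> and \<open>j\<close> permutes the k-sets and moves the
    zeroed entry from one index to the other.\<close>
  define \<pi> where "\<pi> = Transposition.transpose i j"
  have "esym_omit k i (c *\<^sub>R (\<chi> i. 1) :: real ^ 'n)
      = (\<Sum>S | int (card S) = k. \<Prod>m\<in>S. if m = i then 0 else c)"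
    by (simp add: esym_omit_def esym_def cong: if_cong)
  also have "\<dots> = (\<Sum>S | int (card S) = k. \<Prod>m\<in>S. if m = j then 0 else c)"
  proof (rule sum.reindex_bij_witness[where i = "image \<pi>" and j = "image \<pi>"])
    fix S :: "'n set"
    show "(\<Prod>m\<in>\<pi> ` S. if m = j then 0 else c) = (\<Prod>m\<in>S. if m = i then 0 else c)"
      by (subst prod.reindex) (auto simp: \<pi>_def transpose_eq_iff intro!: prod.cong)
  qed (auto simp: \<pi>_def image_image card_image)
  finally show ?thesis
    by (simp add: esym_omit_def esym_def cong: if_cong)
qed

text \<open>By symmetry the n ratios coincide, and they add up to k; no binomial identity has to be
  computed.\<close>

lemma esym_ratio_const:
  assumes "0 < c" "k \<le> CARD('n)"
  shows "esym_ratio k (c *\<^sub>R (\<chi> i. 1) :: real ^ 'n) i = real k / real CARD('n)"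
proof -
  let ?a = "c *\<^sub>R (\<chi> i. 1) :: real ^ 'n"
  have "?a \<in> pos_cone" using assms(1) by (simp add: pos_cone_def)
  have eq: "esym_ratio k ?a j = esym_ratio k ?a i" for j
    using esym_omit_const[of "int k - 1" j c i] by (simp add: esym_ratio_def)
  have "(\<Sum>j\<in>UNIV. esym_ratio k ?a j) = (\<Sum>j\<in>(UNIV :: 'n set). esym_ratio k ?a i)"
    by (rule sum.cong[OF refl eq])
  then show ?thesis
    using sum_esym_ratio[OF \<open>?a \<in> pos_cone\<close> assms(2)] by (simp add: field_simps)
qed

lemma m_quot_const:
  assumes "0 < c" "l < k" "k \<le> CARD('n)"
  shows "m_quot k l (c *\<^sub>R (\<chi> i. 1) :: real ^ 'n) = real CARD('n)"
proof -
  let ?a = "c *\<^sub>R (\<chi> i. 1) :: real ^ 'n"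
  have "?a \<in> pos_cone" using assms(1) by (simp add: pos_cone_def)
  moreover have "esym_ratio k ?a = (\<lambda>_. real k / real CARD('n))"
      "esym_ratio l ?a = (\<lambda>_. real l / real CARD('n))"
    using assms by (intro ext esym_ratio_const; simp)+
  ultimately have "xi_upper k ?a - xi_lower l ?a = (real k - real l) / real CARD('n)"
    using assms by (simp add: xi_upper_eq_Max xi_lower_eq_Min diff_divide_distrib)
  then show ?thesis using assms by (simp add: m_quot_def)
qed

text \<open>The constant vector shows that the choice in \<open>eigenvalues\<close> has a witness.
  The chosen vector v must still be identified, through the characteristic polynomial (t -
  c)^n.\<close>

lemma eigenvalues_scaleR_mat_1:
  "eigenvalues (c *\<^sub>R mat 1 :: real ^ 'n ^ 'n) = c *\<^sub>R (\<chi> i. 1)"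
proof -
  have det: "det (t *\<^sub>R mat 1 - c *\<^sub>R mat 1 :: real ^ 'n ^ 'n) = (\<Prod>i\<in>(UNIV :: 'n set). t - c)" for t
    by (subst det_diagonal) (auto simp: mat_def)
  have "\<forall>t. det (t *\<^sub>R mat 1 - c *\<^sub>R mat 1 :: real ^ 'n ^ 'n)
      = (\<Prod>i\<in>UNIV. t - (c *\<^sub>R (\<chi> i. 1) :: real ^ 'n) $ i)"
    by (simp add: det)
  then have "\<forall>t. det (t *\<^sub>R mat 1 - c *\<^sub>R mat 1 :: real ^ 'n ^ 'n)
      = (\<Prod>i\<in>UNIV. t - eigenvalues (c *\<^sub>R mat 1 :: real ^ 'n ^ 'n) $ i)"
    unfolding eigenvalues_def by (rule someI)
  then have "(\<Prod>i\<in>(UNIV :: 'n set). t - c)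
      = (\<Prod>i\<in>UNIV. t - eigenvalues (c *\<^sub>R mat 1 :: real ^ 'n ^ 'n) $ i)" for t
    by (simp only: det)
  \<comment> \<open>Substituting t = v_j annihilates the product over v, so (v_j - c)^n = 0 and v_j
    = c.\<close>
  moreover have "(\<Prod>i\<in>UNIV. eigenvalues (c *\<^sub>R mat 1 :: real ^ 'n ^ 'n) $ j
      - eigenvalues (c *\<^sub>R mat 1 :: real ^ 'n ^ 'n) $ i) = 0" for j
    by (rule prod_zero) auto
  ultimately have "(\<Prod>i\<in>(UNIV :: 'n set). eigenvalues (c *\<^sub>R mat 1 :: real ^ 'n ^ 'n) $ j - c) = 0" for j
    by metis
  then show ?thesis by (simp add: vec_eq_iff)
qed

lemma c_star_pos:
  assumes "l < k" "k \<le> n"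
  shows "0 < c_star n k l"
  using assms by (simp add: c_star_def)

text \<open>In view of \<open>esym_const\<close> this is sigma_k = sigma_l at the constant vector.
  It amounts to c^(k-l) being the quotient of the binomials, multiplied through by c^l.\<close>

lemma c_star_power:
  assumes "l < k" "k \<le> n"
  shows "real (n choose k) * c_star n k l ^ k = real (n choose l) * c_star n k l ^ l"
proof -
  let ?q = "real (n choose l) / real (n choose k)"
  have "?q > 0" using assms by simp
  then have "c_star n k l ^ (k - l) = ?q"
    using assms by (simp add: c_star_def of_nat_diff powr_powr flip: powr_realpow)
  moreover have "c_star n k l ^ k = c_star n k l ^ (k - l) * c_star n k l ^ l"
    using assms by (simp flip: power_add)
  ultimately show ?thesis using assms by simp
qed

theorem proposition1p1:
  fixes k l :: nat
  assumes "CARD('n::finite) \<ge> 3" and "l < k" and "k \<le> CARD('n)"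
  shows "(k - l \<ge> 2 \<longrightarrow> (A_tilde k l :: (real ^ 'n ^ 'n) set) = A_set k l)
    \<and> ((A_tilde CARD('n) 0 :: (real ^ 'n ^ 'n) set) = A_set CARD('n) 0
        \<and> (\<forall>a \<in> (pos_cone :: (real ^ 'n) set). m_quot CARD('n) 0 a = real CARD('n)))
    \<and> (c_star CARD('n) k l *\<^sub>R mat 1 \<in> (A_tilde k l :: (real ^ 'n ^ 'n) set)
        \<and> m_quot k l (c_star CARD('n) k l *\<^sub>R (\<chi> i. 1) :: real ^ 'n) = real CARD('n))"
proof (intro conjI impI ballI)
  assume "k - l \<ge> 2"
  \<comment> \<open>Eigenvalue vectors of members of \<open>A_set\<close> lie in
    \<open>pos_cone\<close>, so the extra condition m > 2 holds automatically.\<close>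
  then show "(A_tilde k l :: (real ^ 'n ^ 'n) set) = A_set k l"
    using m_quot_gt_2[where 'n = 'n] assms by (auto simp: A_tilde_def A_set_def)
next
  show "(A_tilde CARD('n) 0 :: (real ^ 'n ^ 'n) set) = A_set CARD('n) 0"
    using m_quot_card_0[where 'n = 'n] assms by (auto simp: A_tilde_def A_set_def)
next
  fix a :: "real ^ 'n"
  assume "a \<in> pos_cone"
  then show "m_quot CARD('n) 0 a = real CARD('n)" by (rule m_quot_card_0)
next
  let ?c = "c_star CARD('n) k l"
  have c: "0 < ?c" using assms by (simp add: c_star_pos)
  show m: "m_quot k l (?c *\<^sub>R (\<chi> i. 1) :: real ^ 'n) = real CARD('n)"
    using c assms(2,3) by (rule m_quot_const)
  have "esym (int k) (?c *\<^sub>R (\<chi> i. 1) :: real ^ 'n) = esym (int l) (?c *\<^sub>R (\<chi> i. 1) :: real ^ 'n)"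
    unfolding esym_const using assms(2,3) by (rule c_star_power)
  moreover have "?c *\<^sub>R (\<chi> i. 1) \<in> (pos_cone :: (real ^ 'n) set)"
    using c by (simp add: pos_cone_def)
  moreover have "?c *\<^sub>R mat 1 \<in> (sym_matrices :: (real ^ 'n ^ 'n) set)"
    by (simp add: sym_matrices_def transpose_scalar)
  ultimately show "?c *\<^sub>R mat 1 \<in> (A_tilde k l :: (real ^ 'n ^ 'n) set)"
    using m assms(1) by (simp add: A_tilde_def A_set_def eigenvalues_scaleR_mat_1)
qed

end
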